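(* Let $H$ be a nonempty set, let $L,X$ be objects of $\mathrm{Set}_H$, let $\sigma:L\otimes L\to L\otimes L$ be a dynamical Yang-Baxter map and let $k:L\otimes X\to L\otimes X$ be a dynamical reflection map associated with $\sigma$. Put $$\tilde\sigma=\varphi_2(L,L)^{-1}Q(\sigma)\varphi_2(L,L):Q(L)\times_HQ(L)\to Q(L)\times_HQ(L),$$ $$\tilde k=\varphi_2(L,X)^{-1}Q(k)\varphi_2(L,X):Q(L)\times_HQ(X)\to Q(L)\times_HQ(X).$$ Then, writing $a=a_{Q(L)Q(L)Q(X)}$, the morphism $\tilde k$ satisfies the reflection equation associated with $\tilde\sigma$ in $\mathrm{Quiv}_H$: $$a^{-1}(1_{Q(L)}\times_H\tilde k)\,a\,(\tilde\sigma\times_H1_{Q(X)})\,a^{-1}(1_{Q(L)}\times_H\tilde k)\,a\,(\tilde\sigma\times_H1_{Q(X)})\,a^{-1}$$ $$=(\tilde\sigma\times_H1_{Q(X)})\,a^{-1}(1_{Q(L)}\times_H\tilde k)\,a\,(\tilde\sigma\times_H1_{Q(X)})\,a^{-1}(1_{Q(L)}\times_H\tilde k).$$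
   Context: Category $\mathrm{Set}_H$: objects are pairs $(X,\cdot_X)$ of a set $X$ and a map $\cdot_X:H\times X\to H$ (write $\lambda x=\lambda\cdot_Xx$). A morphism $f:X\to Y$ is a map $f:H\to\mathrm{Map}(X,Y)$ with $\lambda\cdot_Yf(\lambda)(x)=\lambda\cdot_Xx$ for all $\lambda,x$; $(gf)(\lambda)=g(\lambda)\circ f(\lambda)$. It is a tensor category: $X\otimes Y=X\times Y$ with $\lambda\cdot_{X\otimes Y}(x,y)=(\lambda\cdot_Xx)\cdot_Yy$; $(f\otimes g)(\lambda)(x,y)=(f(\lambda)(x),g(\lambda\cdot_Xx)(y))$; unit $I=\{\bullet\}$, $\lambda\cdot_I\bullet=\lambda$; $a_{XYZ}(\lambda)((x,y),z)=(x,(y,z))$, $l_X(\lambda)(\bullet,x)=x$, $r_X(\lambda)(x,\bullet)=x$. A dynamical Yang-Baxter map is a morphism $\sigma:L\otimes L\to L\otimes L$ of $\mathrm{Set}_H$ satisfying the braid relation $a_{LLL}(\sigma\otimes1_L)a_{LLL}^{-1}(1_L\otimes\sigma)a_{LLL}(\sigma\otimes1_L)=(1_L\otimes\sigma)a_{LLL}(\sigma\otimes1_L)a_{LLL}^{-1}(1_L\otimes\sigma)a_{LLL}$. A dynamical reflection map associated with $\sigma$ is a morphism $k:L\otimes X\to L\otimes X$ of $\mathrm{Set}_H$ satisfying $$a_{LLX}^{-1}(1_L\otimes k)a_{LLX}(\sigma\otimes1_X)a_{LLX}^{-1}(1_L\otimes k)a_{LLX}(\sigma\otimes1_X)a_{LLX}^{-1}=(\sigma\otimes1_X)a_{LLX}^{-1}(1_L\otimes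 k)a_{LLX}(\sigma\otimes1_X)a_{LLX}^{-1}(1_L\otimes k).$$ Category $\mathrm{Quiv}_H$: objects are quivers over $H$, i.e. sets $Q$ with maps $\mathfrak s_Q,\mathfrak t_Q:Q\to H$; morphisms are maps commuting with source and target. It is a tensor category with $Q\times_HR=\{(a,b)\in Q\times R\mid\mathfrak t_Q(a)=\mathfrak s_R(b)\}$, $\mathfrak s(a,b)=\mathfrak s_Q(a)$, $\mathfrak t(a,b)=\mathfrak t_R(b)$, $f\times_Hg=(f\times g)|_{Q\times_HR}$, associativity constraint $a_{QRS}((a,b),c)=(a,(b,c))$ and unit $H$ with $\mathfrak s_H=\mathfrak t_H=1_H$. Functor $Q:\mathrm{Set}_H\to\mathrm{Quiv}_H$: $Q(X)=H\times X$ with $\mathfrak s_{Q(X)}(\lambda,x)=\lambda$, $\mathfrak t_{Q(X)}(\lambda,x)=\lambda\cdot_Xx$, and $Q(f)(\lambda,x)=(\lambda,f(\lambda)(x))$. The isomorphism $\varphi_2(X,Y):Q(X)\times_HQ(Y)\to Q(X\otimes Y)$ is $((\lambda,x),(\kappa,y))\mapsto(\lambda,(x,y))$. *)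

theory Defs
  imports "HOL-Library.FuncSet"
begin

text \<open>
  The categories \<open>Set\<^sub>H\<close> and \<open>Quiv\<^sub>H\<close> for a set \<open>H\<close>. Carriers are sets, so that
  objects may be empty. Every structure map and every underlying map of an arrow is extensional
  (\<open>undefined\<close> off its carrier), and arrows carry their domain and codomain, so that equality
  of arrows in the category is equality in HOL. Composition is total; it is meaningful for
  composable arrows.
\<close>

section \<open>The tensor category of dynamical sets\<close>

record ('h, 'x) dset =
  Car :: "'x set"
  act :: "'h \<times> 'x \<Rightarrow> 'h"

record ('h, 'x, 'y) darr =
  dDom :: "('h, 'x) dset"
  dCod :: "('h, 'y) dset"
  dMap :: "'h \<Rightarrow> 'x \<Rightarrow> 'y"

definition dset_obj :: "'h set \<Rightarrow> ('h, 'x) dset \<Rightarrow> bool" where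
  "dset_obj H X \<longleftrightarrow> act X \<in> H \<times> Car X \<rightarrow>\<^sub>E H"

definition dset_hom ::
  "'h set \<Rightarrow> ('h, 'x, 'y) darr \<Rightarrow> ('h, 'x) dset \<Rightarrow> ('h, 'y) dset \<Rightarrow> bool" where
  "dset_hom H f X Y \<longleftrightarrow>
     dset_obj H X \<and> dset_obj H Y \<and> dDom f = X \<and> dCod f = Y \<and>
     dMap f \<in> H \<rightarrow>\<^sub>E (Car X \<rightarrow>\<^sub>E Car Y) \<and>
     (\<forall>l\<in>H. \<forall>x\<in>Car X. act Y (l, dMap f l x) = act X (l, x))"

definition dset_id :: "'h set \<Rightarrow> ('h, 'x) dset \<Rightarrow> ('h, 'x, 'x) darr" where
  "dset_id H X = \<lparr>dDom = X, dCod = X, dMap = (\<lambda>l\<in>H. \<lambda>x\<in>Car X. x)\<rparr>"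

definition dset_comp ::
  "('h, 'y, 'z) darr \<Rightarrow> 'h set \<Rightarrow> ('h, 'x, 'y) darr \<Rightarrow> ('h, 'x, 'z) darr"
  ("(_ \<circ>\<^bsub>_\<^esub>/ _)" [56, 0, 55] 55) where
  "g \<circ>\<^bsub>H\<^esub> f =
     \<lparr>dDom = dDom f, dCod = dCod g,
      dMap = (\<lambda>l\<in>H. compose (Car (dDom f)) (dMap g l) (dMap f l))\<rparr>"

definition dset_inv :: "'h set \<Rightarrow> ('h, 'x, 'y) darr \<Rightarrow> ('h, 'y, 'x) darr" where
  "dset_inv H f =
     (THE g. dset_hom H g (dCod f) (dDom f) \<and>
        g \<circ>\<^bsub>H\<^esub> f = dset_id H (dDom f) \<and> f \<circ>\<^bsub>H\<^esub> g = dset_id H (dCod f))"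

definition dset_tensor ::
  "('h, 'x) dset \<Rightarrow> 'h set \<Rightarrow> ('h, 'y) dset \<Rightarrow> ('h, 'x \<times> 'y) dset"
  ("(_ \<otimes>\<^bsub>_\<^esub>/ _)" [71, 0, 71] 70) where
  "X \<otimes>\<^bsub>H\<^esub> Y =
     \<lparr>Car = Car X \<times> Car Y,
      act = (\<lambda>(l, (x, y))\<in>H \<times> (Car X \<times> Car Y). act Y (act X (l, x), y))\<rparr>"

definition dset_tensor_arr ::
  "('h, 'x, 'x2) darr \<Rightarrow> 'h set \<Rightarrow> ('h, 'y, 'y2) darr \<Rightarrow> ('h, 'x \<times> 'y, 'x2 \<times> 'y2) darr"
  ("(_ \<boxtimes>\<^bsub>_\<^esub>/ _)" [71, 0, 71] 70) where
  "f \<boxtimes>\<^bsub>H\<^esub> g =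
     \<lparr>dDom = dDom f \<otimes>\<^bsub>H\<^esub> dDom g, dCod = dCod f \<otimes>\<^bsub>H\<^esub> dCod g,
      dMap = (\<lambda>l\<in>H. \<lambda>(x, y)\<in>Car (dDom f) \<times> Car (dDom g).
                (dMap f l x, dMap g (act (dDom f) (l, x)) y))\<rparr>"

definition dset_assoc ::
  "'h set \<Rightarrow> ('h, 'x) dset \<Rightarrow> ('h, 'y) dset \<Rightarrow> ('h, 'z) dset \<Rightarrow>
     ('h, ('x \<times> 'y) \<times> 'z, 'x \<times> ('y \<times> 'z)) darr" where
  "dset_assoc H X Y Z =
     \<lparr>dDom = (X \<otimes>\<^bsub>H\<^esub> Y) \<otimes>\<^bsub>H\<^esub> Z, dCod = X \<otimes>\<^bsub>H\<^esub> (Y \<otimes>\<^bsub>H\<^esub> Z),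
      dMap = (\<lambda>l\<in>H. \<lambda>((x, y), z)\<in>(Car X \<times> Car Y) \<times> Car Z. (x, (y, z)))\<rparr>"

definition dynamical_YB_map ::
  "'h set \<Rightarrow> ('h, 'l) dset \<Rightarrow> ('h, 'l \<times> 'l, 'l \<times> 'l) darr \<Rightarrow> bool" where
  "dynamical_YB_map H L \<sigma> \<longleftrightarrow>
     dset_hom H \<sigma> (L \<otimes>\<^bsub>H\<^esub> L) (L \<otimes>\<^bsub>H\<^esub> L) \<and>
     (let a = dset_assoc H L L L; a' = dset_inv H a;
          s1 = \<sigma> \<boxtimes>\<^bsub>H\<^esub> dset_id H L; s2 = dset_id H L \<boxtimes>\<^bsub>H\<^esub> \<sigma>
      in a \<circ>\<^bsub>H\<^esub> s1 \<circ>\<^bsub>H\<^esub> a' \<circ>\<^bsub>H\<^esub> s2 \<circ>\<^bsub>H\<^esub> a \<circ>\<^bsub>H\<^esub> s1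
       = s2 \<circ>\<^bsub>H\<^esub> a \<circ>\<^bsub>H\<^esub> s1 \<circ>\<^bsub>H\<^esub> a' \<circ>\<^bsub>H\<^esub> s2 \<circ>\<^bsub>H\<^esub> a)"

definition dynamical_reflection_map ::
  "'h set \<Rightarrow> ('h, 'l) dset \<Rightarrow> ('h, 'x) dset \<Rightarrow>
     ('h, 'l \<times> 'l, 'l \<times> 'l) darr \<Rightarrow> ('h, 'l \<times> 'x, 'l \<times> 'x) darr \<Rightarrow> bool" where
  "dynamical_reflection_map H L X \<sigma> k \<longleftrightarrow>
     dset_hom H k (L \<otimes>\<^bsub>H\<^esub> X) (L \<otimes>\<^bsub>H\<^esub> X) \<and>
     (let a = dset_assoc H L L X; a' = dset_inv H a;
          s = \<sigma> \<boxtimes>\<^bsub>H\<^esub> dset_id H X; r = dset_id H L \<boxtimes>\<^bsub>H\<^esub> k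
      in a' \<circ>\<^bsub>H\<^esub> r \<circ>\<^bsub>H\<^esub> a \<circ>\<^bsub>H\<^esub> s \<circ>\<^bsub>H\<^esub> a' \<circ>\<^bsub>H\<^esub> r \<circ>\<^bsub>H\<^esub> a \<circ>\<^bsub>H\<^esub> s \<circ>\<^bsub>H\<^esub> a'
       = s \<circ>\<^bsub>H\<^esub> a' \<circ>\<^bsub>H\<^esub> r \<circ>\<^bsub>H\<^esub> a \<circ>\<^bsub>H\<^esub> s \<circ>\<^bsub>H\<^esub> a' \<circ>\<^bsub>H\<^esub> r)"


section \<open>The tensor category of quivers\<close>

record ('h, 'q) quiver =
  Arr :: "'q set"
  src :: "'q \<Rightarrow> 'h"
  tgt :: "'q \<Rightarrow> 'h"

record ('h, 'q, 'r) qarr =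
  qDom :: "('h, 'q) quiver"
  qCod :: "('h, 'r) quiver"
  qMap :: "'q \<Rightarrow> 'r"

definition quiv_obj :: "'h set \<Rightarrow> ('h, 'q) quiver \<Rightarrow> bool" where
  "quiv_obj H Q \<longleftrightarrow> src Q \<in> Arr Q \<rightarrow>\<^sub>E H \<and> tgt Q \<in> Arr Q \<rightarrow>\<^sub>E H"

definition quiv_hom ::
  "'h set \<Rightarrow> ('h, 'q, 'r) qarr \<Rightarrow> ('h, 'q) quiver \<Rightarrow> ('h, 'r) quiver \<Rightarrow> bool" where
  "quiv_hom H f Q R \<longleftrightarrow>
     quiv_obj H Q \<and> quiv_obj H R \<and> qDom f = Q \<and> qCod f = R \<and>
     qMap f \<in> Arr Q \<rightarrow>\<^sub>E Arr R \<and>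
     (\<forall>q\<in>Arr Q. src R (qMap f q) = src Q q \<and> tgt R (qMap f q) = tgt Q q)"

definition quiv_id :: "('h, 'q) quiver \<Rightarrow> ('h, 'q, 'q) qarr" where
  "quiv_id Q = \<lparr>qDom = Q, qCod = Q, qMap = (\<lambda>q\<in>Arr Q. q)\<rparr>"

definition quiv_comp ::
  "('h, 'r, 's) qarr \<Rightarrow> ('h, 'q, 'r) qarr \<Rightarrow> ('h, 'q, 's) qarr" (infixr "\<odot>" 55) where
  "g \<odot> f = \<lparr>qDom = qDom f, qCod = qCod g, qMap = compose (Arr (qDom f)) (qMap g) (qMap f)\<rparr>"

definition quiv_inv :: "'h set \<Rightarrow> ('h, 'q, 'r) qarr \<Rightarrow> ('h, 'r, 'q) qarr" where
  "quiv_inv H f =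
     (THE g. quiv_hom H g (qCod f) (qDom f) \<and>
        g \<odot> f = quiv_id (qDom f) \<and> f \<odot> g = quiv_id (qCod f))"

definition fiber_carrier :: "('h, 'q) quiver \<Rightarrow> ('h, 'r) quiver \<Rightarrow> ('q \<times> 'r) set" where
  "fiber_carrier Q R = {(a, b). a \<in> Arr Q \<and> b \<in> Arr R \<and> tgt Q a = src R b}"

definition quiv_tensor ::
  "('h, 'q) quiver \<Rightarrow> ('h, 'r) quiver \<Rightarrow> ('h, 'q \<times> 'r) quiver" (infix "\<otimes>\<^sub>q" 70) where
  "Q \<otimes>\<^sub>q R =
     \<lparr>Arr = fiber_carrier Q R,
      src = (\<lambda>(a, b)\<in>fiber_carrier Q R. src Q a),
      tgt = (\<lambda>(a, b)\<in>fiber_carrier Q R. tgt R b)\<rparr>"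

definition quiv_tensor_arr ::
  "('h, 'q, 'q2) qarr \<Rightarrow> ('h, 'r, 'r2) qarr \<Rightarrow> ('h, 'q \<times> 'r, 'q2 \<times> 'r2) qarr"
  (infix "\<boxtimes>\<^sub>q" 70) where
  "f \<boxtimes>\<^sub>q g =
     \<lparr>qDom = qDom f \<otimes>\<^sub>q qDom g, qCod = qCod f \<otimes>\<^sub>q qCod g,
      qMap = restrict (map_prod (qMap f) (qMap g)) (fiber_carrier (qDom f) (qDom g))\<rparr>"

definition quiv_assoc ::
  "('h, 'q) quiver \<Rightarrow> ('h, 'r) quiver \<Rightarrow> ('h, 's) quiver \<Rightarrow>
     ('h, ('q \<times> 'r) \<times> 's, 'q \<times> ('r \<times> 's)) qarr" where
  "quiv_assoc Q R S =
     \<lparr>qDom = (Q \<otimes>\<^sub>q R) \<otimes>\<^sub>q S, qCod = Q \<otimes>\<^sub>q (R \<otimes>\<^sub>q S),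
      qMap = (\<lambda>((a, b), c)\<in>Arr ((Q \<otimes>\<^sub>q R) \<otimes>\<^sub>q S). (a, (b, c)))\<rparr>"


section \<open>The functor from dynamical sets to quivers\<close>

definition Qobj :: "'h set \<Rightarrow> ('h, 'x) dset \<Rightarrow> ('h, 'h \<times> 'x) quiver" where
  "Qobj H X =
     \<lparr>Arr = H \<times> Car X,
      src = (\<lambda>(l, x)\<in>H \<times> Car X. l),
      tgt = (\<lambda>(l, x)\<in>H \<times> Car X. act X (l, x))\<rparr>"

definition Qarr :: "'h set \<Rightarrow> ('h, 'x, 'y) darr \<Rightarrow> ('h, 'h \<times> 'x, 'h \<times> 'y) qarr" where
  "Qarr H f =
     \<lparr>qDom = Qobj H (dDom f), qCod = Qobj H (dCod f),
      qMap = (\<lambda>(l, x)\<in>H \<times> Car (dDom f). (l, dMap f l x))\<rparr>"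

definition phi2 ::
  "'h set \<Rightarrow> ('h, 'x) dset \<Rightarrow> ('h, 'y) dset \<Rightarrow>
     ('h, ('h \<times> 'x) \<times> ('h \<times> 'y), 'h \<times> ('x \<times> 'y)) qarr" where
  "phi2 H X Y =
     \<lparr>qDom = Qobj H X \<otimes>\<^sub>q Qobj H Y, qCod = Qobj H (X \<otimes>\<^bsub>H\<^esub> Y),
      qMap = (\<lambda>((l, x), (m, y))\<in>fiber_carrier (Qobj H X) (Qobj H Y). (l, (x, y)))\<rparr>"

end

theory Submission
  imports Defs
begin

text \<open>
  The functor \<open>Q\<close> is strong monoidal. Say that a quiver \<open>Q'\<close> is a copy of \<open>Q(X)\<close> if a bijection
  \<open>e\<close> identifies the pairs \<open>(\<lambda>, x)\<close> with the arrows of \<open>Q'\<close>, and that an arrow of quivers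
  represents an arrow of dynamical sets if it corresponds to it under such identifications.
  Representation is compatible with composition, tensor products, inverses and associators, and
  \<open>\<phi>\<^sub>2\<close> represents an identity. Hence both sides of the reflection equation for \<open>k\<close> are represented
  by the corresponding sides for \<open>k'\<close>, and an arrow has at most one representative.
\<close>

section \<open>Arrows of dynamical sets\<close>

lemma dset_obj_act [simp, intro]:
  "dset_obj H X \<Longrightarrow> l \<in> H \<Longrightarrow> x \<in> Car X \<Longrightarrow> act X (l, x) \<in> H"
  by (auto simp: dset_obj_def)

lemma Car_tensor [simp]: "Car (X \<otimes>\<^bsub>H\<^esub> Y) = Car X \<times> Car Y"
  by (simp add: dset_tensor_def)

lemma act_tensor [simp]:
  "l \<in> H \<Longrightarrow> x \<in> Car X \<Longrightarrow> y \<in> Car Y \<Longrightarrow> act (X \<otimes>\<^bsub>H\<^esub> Y) (l, (x, y)) = act Y (act X (l, x), y)"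
  by (simp add: dset_tensor_def)

lemma dset_obj_tensor [simp, intro]:
  "dset_obj H X \<Longrightarrow> dset_obj H Y \<Longrightarrow> dset_obj H (X \<otimes>\<^bsub>H\<^esub> Y)"
  by (auto simp: dset_obj_def dset_tensor_def)

lemma dset_homD:
  assumes "dset_hom H f X Y"
  shows "dset_obj H X" "dset_obj H Y" "dDom f = X" "dCod f = Y"
    and "\<And>l x. l \<in> H \<Longrightarrow> x \<in> Car X \<Longrightarrow> dMap f l x \<in> Car Y"
    and "\<And>l x. l \<in> H \<Longrightarrow> x \<in> Car X \<Longrightarrow> act Y (l, dMap f l x) = act X (l, x)"
  using assms by (auto simp: dset_hom_def dest!: PiE_mem)

text \<open>Arrows record their domain and codomain, and their maps are \<open>undefined\<close> off
  the carriers. Extensionality, once in \<lambda> and once in x, therefore turns agreement on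
  carriers into HOL equality.\<close>

lemma dset_hom_eqI:
  fixes f g :: "('h, 'x, 'y) darr"
  assumes f: "dset_hom H f X Y" and g: "dset_hom H g X Y"
    and eq: "\<And>l x. l \<in> H \<Longrightarrow> x \<in> Car X \<Longrightarrow> dMap f l x = dMap g l x"
  shows "f = g"
proof -
  have "dMap f = dMap g"
  proof (rule PiE_ext)
    show "dMap f \<in> H \<rightarrow>\<^sub>E (Car X \<rightarrow>\<^sub>E Car Y)" "dMap g \<in> H \<rightarrow>\<^sub>E (Car X \<rightarrow>\<^sub>E Car Y)"
      using f g by (auto simp: dset_hom_def)
    fix l assume l: "l \<in> H"
    show "dMap f l = dMap g l"
    proof (rule PiE_ext)
      show "dMap f l \<in> Car X \<rightarrow>\<^sub>E Car Y" "dMap g l \<in> Car X \<rightarrow>\<^sub>E Car Y"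
        using f g l by (auto simp: dset_hom_def)
    qed (use l eq in auto)
  qed
  then show ?thesis
    using dset_homD(3,4)[OF f] dset_homD(3,4)[OF g] by simp
qed

section \<open>Identities, composition and inverses of dynamical arrows\<close>

lemma dset_hom_id: "dset_obj H X \<Longrightarrow> dset_hom H (dset_id H X) X X"
  by (auto simp: dset_hom_def dset_id_def)

lemma dMap_id [simp]: "l \<in> H \<Longrightarrow> x \<in> Car X \<Longrightarrow> dMap (dset_id H X) l x = x"
  by (simp add: dset_id_def)

lemma dMap_comp:
  "l \<in> H \<Longrightarrow> x \<in> Car (dDom f) \<Longrightarrow> dMap (g \<circ>\<^bsub>H\<^esub> f) l x = dMap g l (dMap f l x)"
  by (simp add: dset_comp_def compose_def)

lemma dset_hom_comp:
  assumes f: "dset_hom H f X Y" and g: "dset_hom H g Y Z"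
  shows "dset_hom H (g \<circ>\<^bsub>H\<^esub> f) X Z"
  using dset_homD[OF f] dset_homD[OF g]
  by (auto simp: dset_hom_def dset_comp_def compose_def)

lemma dset_id_comp:
  assumes f: "dset_hom H f X Y" shows "dset_id H Y \<circ>\<^bsub>H\<^esub> f = f"
proof (rule dset_hom_eqI)
  show "dset_hom H (dset_id H Y \<circ>\<^bsub>H\<^esub> f) X Y"
    using dset_homD(2)[OF f] by (intro dset_hom_comp[OF f] dset_hom_id)
qed (use f dset_homD[OF f] in \<open>auto simp: dMap_comp\<close>)

lemma dset_comp_id:
  assumes f: "dset_hom H f X Y" shows "f \<circ>\<^bsub>H\<^esub> dset_id H X = f"
proof (rule dset_hom_eqI)
  show "dset_hom H (f \<circ>\<^bsub>H\<^esub> dset_id H X) X Y"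
    using dset_homD(1)[OF f] by (intro dset_hom_comp[OF _ f] dset_hom_id)
qed (use f dset_homD[OF f] in \<open>auto simp: dset_comp_def dset_id_def compose_def\<close>)

text \<open>As \<open>dset_inv\<close> is a definite description, uniqueness has to be shown: h =
  h(fg) = (hf)g = g, evaluated at points.\<close>

lemma dset_inv_eqI:
  fixes f :: "('h, 'x, 'y) darr"
  assumes f: "dset_hom H f X Y" and g: "dset_hom H g Y X"
    and gf: "g \<circ>\<^bsub>H\<^esub> f = dset_id H X" and fg: "f \<circ>\<^bsub>H\<^esub> g = dset_id H Y"
  shows "dset_inv H f = g"
  unfolding dset_inv_def dset_homD(3,4)[OF f]
proof (rule the_equality)
  fix h assume h: "dset_hom H h Y X \<and> h \<circ>\<^bsub>H\<^esub> f = dset_id H X \<and> f \<circ>\<^bsub>H\<^esub> h = dset_id H Y"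
  show "h = g"
  proof (rule dset_hom_eqI)
    fix l y assume ly: "l \<in> H" "y \<in> Car Y"
    let ?x = "dMap g l y"
    have x: "?x \<in> Car X" using dset_homD(5)[OF g ly] .
    have "dMap f l ?x = y"
      using dMap_comp[of l H y g f] ly fg dset_homD(3)[OF g] by simp
    moreover have "dMap h l (dMap f l ?x) = ?x"
      using dMap_comp[of l H ?x f h] ly x h dset_homD(3)[OF f] by simp
    ultimately show "dMap h l y = ?x" by simp
  qed (use g h in auto)
qed (use assms in auto)

section \<open>Tensor products of dynamical arrows and associators\<close>

lemma dMap_tensor_arr [simp]:
  "l \<in> H \<Longrightarrow> x \<in> Car (dDom f) \<Longrightarrow> y \<in> Car (dDom g) \<Longrightarrow>
     dMap (f \<boxtimes>\<^bsub>H\<^esub> g) l (x, y) = (dMap f l x, dMap g (act (dDom f) (l, x)) y)"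
  by (simp add: dset_tensor_arr_def)

text \<open>Since f preserves the action, the second coordinate of the image is acted on at the
  parameter \<lambda>x. This is the parameter at which g is evaluated, so preservation of the action
  by g finishes the argument.\<close>

lemma dset_hom_tensor:
  assumes f: "dset_hom H f X X'" and g: "dset_hom H g Y Y'"
  shows "dset_hom H (f \<boxtimes>\<^bsub>H\<^esub> g) (X \<otimes>\<^bsub>H\<^esub> Y) (X' \<otimes>\<^bsub>H\<^esub> Y')"
  using dset_homD[OF f] dset_homD[OF g]
  by (auto simp: dset_hom_def dset_tensor_arr_def split: if_splits)

lemma dset_hom_assoc:
  assumes "dset_obj H X" "dset_obj H Y" "dset_obj H Z"
  shows "dset_hom H (dset_assoc H X Y Z) ((X \<otimes>\<^bsub>H\<^esub> Y) \<otimes>\<^bsub>H\<^esub> Z) (X \<otimes>\<^bsub>H\<^esub> (Y \<otimes>\<^bsub>H\<^esub> Z))"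
  using assms by (auto simp: dset_hom_def dset_assoc_def split: if_splits)

text \<open>Turns the description behind \<open>dset_inv\<close> into usable facts. Rebracketing
  backwards preserves the action, since both bracketings act by ((\<lambda>x)y)z, and it is a
  two-sided inverse.\<close>

lemma dset_assoc_inv:
  fixes X :: "('h, 'x) dset" and Y :: "('h, 'y) dset" and Z :: "('h, 'z) dset"
  assumes obj: "dset_obj H X" "dset_obj H Y" "dset_obj H Z"
  defines "XYZ \<equiv> (X \<otimes>\<^bsub>H\<^esub> Y) \<otimes>\<^bsub>H\<^esub> Z" and "XYZ' \<equiv> X \<otimes>\<^bsub>H\<^esub> (Y \<otimes>\<^bsub>H\<^esub> Z)"
    and "a \<equiv> dset_assoc H X Y Z"
  shows "dset_hom H (dset_inv H a) XYZ' XYZ"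
    and "dset_inv H a \<circ>\<^bsub>H\<^esub> a = dset_id H XYZ" and "a \<circ>\<^bsub>H\<^esub> dset_inv H a = dset_id H XYZ'"
proof -
  define b :: "('h, 'x \<times> 'y \<times> 'z, ('x \<times> 'y) \<times> 'z) darr" where
    "b = \<lparr>dDom = XYZ', dCod = XYZ,
      dMap = (\<lambda>l\<in>H. \<lambda>(x, (y, z))\<in>Car X \<times> Car Y \<times> Car Z. ((x, y), z))\<rparr>"
  have a: "dset_hom H a XYZ XYZ'"
    unfolding a_def XYZ_def XYZ'_def using obj by (rule dset_hom_assoc)
  have b: "dset_hom H b XYZ' XYZ"
    using obj by (auto simp: dset_hom_def b_def XYZ_def XYZ'_def split: if_splits)
  have XYZ: "dset_obj H XYZ" "dset_obj H XYZ'"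
    using obj by (auto simp: XYZ_def XYZ'_def)
  have ba: "b \<circ>\<^bsub>H\<^esub> a = dset_id H XYZ"
    by (rule dset_hom_eqI[OF dset_hom_comp[OF a b] dset_hom_id[OF XYZ(1)]])
      (auto simp: dMap_comp dset_homD(3)[OF a] a_def b_def dset_assoc_def XYZ_def)
  have ab: "a \<circ>\<^bsub>H\<^esub> b = dset_id H XYZ'"
    by (rule dset_hom_eqI[OF dset_hom_comp[OF b a] dset_hom_id[OF XYZ(2)]])
      (auto simp: dMap_comp dset_homD(3)[OF b] a_def b_def dset_assoc_def XYZ'_def)
  have "dset_inv H a = b"
    using a b ba ab by (rule dset_inv_eqI)
  then show "dset_hom H (dset_inv H a) XYZ' XYZ"
    and "dset_inv H a \<circ>\<^bsub>H\<^esub> a = dset_id H XYZ" and "a \<circ>\<^bsub>H\<^esub> dset_inv H a = dset_id H XYZ'"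
    using b ba ab by simp_all
qed

section \<open>Arrows of quivers\<close>

lemma quiv_objD:
  "quiv_obj H Q \<Longrightarrow> q \<in> Arr Q \<Longrightarrow> src Q q \<in> H"
  "quiv_obj H Q \<Longrightarrow> q \<in> Arr Q \<Longrightarrow> tgt Q q \<in> H"
  by (auto simp: quiv_obj_def)

lemma Arr_tensor [simp]: "Arr (Q \<otimes>\<^sub>q R) = fiber_carrier Q R"
  by (simp add: quiv_tensor_def)

lemma quiv_obj_tensor [intro]:
  "quiv_obj H Q \<Longrightarrow> quiv_obj H R \<Longrightarrow> quiv_obj H (Q \<otimes>\<^sub>q R)"
  by (auto simp: quiv_obj_def quiv_tensor_def fiber_carrier_def)

lemma quiv_hom_eqI:
  fixes f g :: "('h, 'q, 'r) qarr"
  assumes f: "quiv_hom H f Q R" and g: "quiv_hom H g Q R"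
    and eq: "\<And>q. q \<in> Arr Q \<Longrightarrow> qMap f q = qMap g q"
  shows "f = g"
proof -
  have "qMap f = qMap g"
    using f g by (intro PiE_ext[of _ "Arr Q" "\<lambda>_. Arr R"] eq) (auto simp: quiv_hom_def)
  then show ?thesis
    using f g by (simp add: quiv_hom_def)
qed

lemma qMap_comp: "q \<in> Arr (qDom f) \<Longrightarrow> qMap (g \<odot> f) q = qMap g (qMap f q)"
  by (simp add: quiv_comp_def compose_def)

text \<open>The cancellation h = h(fg) = (hf)g = g again, now evaluated at each arrow r of
  R.\<close>

lemma quiv_inv_eqI:
  fixes f :: "('h, 'q, 'r) qarr"
  assumes f: "quiv_hom H f Q R" and g: "quiv_hom H g R Q"
    and gf: "g \<odot> f = quiv_id Q" and fg: "f \<odot> g = quiv_id R"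
  shows "quiv_inv H f = g"
proof -
  have dc: "qDom f = Q" "qCod f = R" "qDom g = R" using f g by (auto simp: quiv_hom_def)
  show ?thesis
    unfolding quiv_inv_def dc
  proof (rule the_equality)
    fix h assume h: "quiv_hom H h R Q \<and> h \<odot> f = quiv_id Q \<and> f \<odot> h = quiv_id R"
    show "h = g"
    proof (rule quiv_hom_eqI)
      fix r assume r: "r \<in> Arr R"
      let ?q = "qMap g r"
      have q: "?q \<in> Arr Q" using g r by (auto simp: quiv_hom_def dest: PiE_mem)
      have "qMap f ?q = r"
        using qMap_comp[of r g f] r fg dc by (simp add: quiv_id_def)
      moreover have "qMap h (qMap f ?q) = ?q"
        using qMap_comp[of ?q f h] q h dc by (simp add: quiv_id_def)
      ultimately show "qMap h r = ?q" by simp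
    qed (use g h in auto)
  qed (use assms in auto)
qed

section \<open>Quivers and arrows representing dynamical sets and their arrows\<close>

text \<open>An isomorphism from Q(X) to the quiver, curried in \<lambda>. Bijectivity is asked over
  each source \<lambda>, which builds in compatibility with sources. The quiver is arbitrary because
  iterated fibre products are not literally of the form \<open>Qobj H X\<close>.\<close>

definition encodes ::
  "'h set \<Rightarrow> ('h \<Rightarrow> 'x \<Rightarrow> 'q) \<Rightarrow> ('h, 'x) dset \<Rightarrow> ('h, 'q) quiver \<Rightarrow> bool" where
  "encodes H e X Q \<longleftrightarrow>
     dset_obj H X \<and> quiv_obj H Q \<and>
     (\<forall>l\<in>H. bij_betw (e l) (Car X) {q \<in> Arr Q. src Q q = l}) \<and>
     (\<forall>l\<in>H. \<forall>x\<in>Car X. tgt Q (e l x) = act X (l, x))"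

lemma encodesD:
  assumes "encodes H e X Q"
  shows "dset_obj H X" "quiv_obj H Q"
    and "\<And>l x. l \<in> H \<Longrightarrow> x \<in> Car X \<Longrightarrow> e l x \<in> Arr Q"
    and "\<And>l x. l \<in> H \<Longrightarrow> x \<in> Car X \<Longrightarrow> src Q (e l x) = l"
    and "\<And>l x. l \<in> H \<Longrightarrow> x \<in> Car X \<Longrightarrow> tgt Q (e l x) = act X (l, x)"
    and "\<And>l. l \<in> H \<Longrightarrow> inj_on (e l) (Car X)"
  using assms by (auto simp: encodes_def bij_betw_def)

text \<open>\<lambda> is the source of q, and the bijection over that source provides x.\<close>

lemma encodes_surj:
  assumes e: "encodes H e X Q" and q: "q \<in> Arr Q"
  obtains l x where "l \<in> H" "x \<in> Car X" "q = e l x"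
proof -
  have l: "src Q q \<in> H" using encodesD(2)[OF e] q by (rule quiv_objD)
  then have "q \<in> e (src Q q) ` Car X"
    using e q by (auto simp: encodes_def bij_betw_def)
  then show ?thesis using l that by auto
qed

lemma encodes_Qobj:
  assumes "dset_obj H X" shows "encodes H Pair X (Qobj H X)"
  using assms
  by (auto simp: encodes_def quiv_obj_def Qobj_def bij_betw_def inj_on_def image_def)

text \<open>With \<open>Pair\<close> for both \<open>e\<close> and \<open>d\<close> this is the
  inverse of \<open>phi2\<close>, sending \<lambda> and (x, y) to ((\<lambda>, x), (\<lambda>x, y)).
  The second arrow starts at \<lambda>x, the target of the first, so the pair is composable.\<close>

definition tensor_enc ::
  "('h, 'x) dset \<Rightarrow> ('h \<Rightarrow> 'x \<Rightarrow> 'q) \<Rightarrow> ('h \<Rightarrow> 'y \<Rightarrow> 'r) \<Rightarrow> 'h \<Rightarrow> 'x \<times> 'y \<Rightarrow> 'q \<times> 'r" where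
  "tensor_enc X e d l = (\<lambda>(x, y). (e l x, d (act X (l, x)) y))"

text \<open>Iterated, this identifies both bracketings of a triple fibre product with the
  corresponding triple tensor products of dynamical sets. For injectivity, the first coordinate
  determines x, hence \<lambda>x, and then the second determines y.\<close>

lemma encodes_tensor:
  assumes e: "encodes H e X Q" and d: "encodes H d Y R"
  shows "encodes H (tensor_enc X e d) (X \<otimes>\<^bsub>H\<^esub> Y) (Q \<otimes>\<^sub>q R)"
  unfolding encodes_def
proof (intro conjI ballI)
  note E = encodesD[OF e] and D = encodesD[OF d]
  show "dset_obj H (X \<otimes>\<^bsub>H\<^esub> Y)" using E D by blast
  show "quiv_obj H (Q \<otimes>\<^sub>q R)" using E D by blast
  have mem: "tensor_enc X e d l p \<in> fiber_carrier Q R"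
    if "l \<in> H" "p \<in> Car X \<times> Car Y" for l p
    using that E D by (auto simp: fiber_carrier_def tensor_enc_def)
  show "tgt (Q \<otimes>\<^sub>q R) (tensor_enc X e d l p) = act (X \<otimes>\<^bsub>H\<^esub> Y) (l, p)"
    if l: "l \<in> H" and p: "p \<in> Car (X \<otimes>\<^bsub>H\<^esub> Y)" for l p
    using mem[of l p] l p E D by (auto simp: quiv_tensor_def tensor_enc_def)
  fix l assume l: "l \<in> H"
  show "bij_betw (tensor_enc X e d l) (Car (X \<otimes>\<^bsub>H\<^esub> Y)) {q \<in> Arr (Q \<otimes>\<^sub>q R). src (Q \<otimes>\<^sub>q R) q = l}"
  proof (rule bij_betw_imageI)
    show "inj_on (tensor_enc X e d l) (Car (X \<otimes>\<^bsub>H\<^esub> Y))"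
      using E(6)[OF l] D(6)[OF dset_obj_act[OF E(1) l]]
      by (auto simp: inj_on_def tensor_enc_def)
    show "tensor_enc X e d l ` Car (X \<otimes>\<^bsub>H\<^esub> Y) = {q \<in> Arr (Q \<otimes>\<^sub>q R). src (Q \<otimes>\<^sub>q R) q = l}"
    proof (intro equalityI subsetI)
      fix q assume "q \<in> tensor_enc X e d l ` Car (X \<otimes>\<^bsub>H\<^esub> Y)"
      then show "q \<in> {q \<in> Arr (Q \<otimes>\<^sub>q R). src (Q \<otimes>\<^sub>q R) q = l}"
        using l mem E by (auto simp: quiv_tensor_def tensor_enc_def)
    next
      fix q assume q: "q \<in> {q \<in> Arr (Q \<otimes>\<^sub>q R). src (Q \<otimes>\<^sub>q R) q = l}"
      obtain a b where ab: "q = (a, b)" by (cases q)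
      have a: "a \<in> Arr Q" and b: "b \<in> Arr R" and m: "tgt Q a = src R b" and s: "src Q a = l"
        using q ab by (auto simp: quiv_tensor_def fiber_carrier_def)
      obtain l' x where x: "l' \<in> H" "x \<in> Car X" "a = e l' x" using encodes_surj[OF e a] .
      obtain m' y where y: "m' \<in> H" "y \<in> Car Y" "b = d m' y" using encodes_surj[OF d b] .
      \<comment> \<open>Sources pin down the parameters: the first arrow starts at \<lambda>, and
        composability makes the second start at \<lambda>x.\<close>
      have "l' = l" "m' = act X (l, x)" using x y s m E D by auto
      then have "q = tensor_enc X e d l (x, y)"
        using x y ab by (simp add: tensor_enc_def)
      then show "q \<in> tensor_enc X e d l ` Car (X \<otimes>\<^bsub>H\<^esub> Y)"
        using x y by auto
    qed
  qed
qed

text \<open>A commutative square between Q(f) and f' whose vertical maps are the two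
  identifications. The typing of both arrows is included, so that it travels along with the
  square.\<close>

definition represents ::
  "'h set \<Rightarrow> ('h \<Rightarrow> 'x \<Rightarrow> 'q) \<Rightarrow> ('h, 'q) quiver \<Rightarrow> ('h \<Rightarrow> 'y \<Rightarrow> 'r) \<Rightarrow> ('h, 'r) quiver \<Rightarrow>
     ('h, 'x, 'y) darr \<Rightarrow> ('h, 'q, 'r) qarr \<Rightarrow> bool" where
  "represents H e Q d R f f' \<longleftrightarrow>
     encodes H e (dDom f) Q \<and> encodes H d (dCod f) R \<and>
     dset_hom H f (dDom f) (dCod f) \<and> quiv_hom H f' Q R \<and>
     (\<forall>l\<in>H. \<forall>x\<in>Car (dDom f). qMap f' (e l x) = d l (dMap f l x))"

lemma representsD:
  assumes "represents H e Q d R f f'"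
  shows "encodes H e (dDom f) Q" "encodes H d (dCod f) R"
    and "dset_hom H f (dDom f) (dCod f)" "quiv_hom H f' Q R" "qDom f' = Q" "qCod f' = R"
    and "\<And>l x. l \<in> H \<Longrightarrow> x \<in> Car (dDom f) \<Longrightarrow> qMap f' (e l x) = d l (dMap f l x)"
  using assms by (auto simp: represents_def quiv_hom_def)

text \<open>Every arrow of Q has the form \<open>e l x\<close>, and both identifications respect
  sources and targets. The pointwise formula thus forces f' to be a quiver morphism, because f
  preserves the action.\<close>

lemma representsI:
  assumes e: "encodes H e X Q" and d: "encodes H d Y R" and f: "dset_hom H f X Y"
    and f': "qDom f' = Q" "qCod f' = R" "qMap f' \<in> extensional (Arr Q)"
    and map: "\<And>l x. l \<in> H \<Longrightarrow> x \<in> Car X \<Longrightarrow> qMap f' (e l x) = d l (dMap f l x)"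
  shows "represents H e Q d R f f'"
proof -
  note F = dset_homD[OF f] and E = encodesD[OF e] and D = encodesD[OF d]
  have *: "qMap f' q \<in> Arr R \<and> src R (qMap f' q) = src Q q \<and> tgt R (qMap f' q) = tgt Q q"
    if q: "q \<in> Arr Q" for q
  proof -
    obtain l x where "l \<in> H" "x \<in> Car X" "q = e l x" using encodes_surj[OF e q] .
    then show ?thesis using map F E D by simp
  qed
  have "quiv_hom H f' Q R"
    unfolding quiv_hom_def using E D f' * by (auto simp: PiE_def)
  then show ?thesis
    unfolding represents_def using e d f F map by simp
qed

lemma represents_unique:
  assumes f: "represents H e Q d R f f'" and g: "represents H e Q d R f g'"
  shows "f' = g'"
proof (rule quiv_hom_eqI[OF representsD(4)[OF f] representsD(4)[OF g]])
  fix q assume q: "q \<in> Arr Q"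
  obtain l x where "l \<in> H" "x \<in> Car (dDom f)" "q = e l x"
    using encodes_surj[OF representsD(1)[OF f] q] .
  then show "qMap f' q = qMap g' q"
    using representsD(7)[OF f] representsD(7)[OF g] by simp
qed

lemma represents_exists:
  fixes f :: "('h, 'x, 'y) darr" and Q :: "('h, 'q) quiver" and R :: "('h, 'r) quiver"
  assumes e: "encodes H e X Q" and d: "encodes H d Y R" and f: "dset_hom H f X Y"
  obtains f' where "represents H e Q d R f f'"
proof -
  \<comment> \<open>The conjugate of Q(f) by the identifications: the source of q recovers
    \<lambda>, and \<open>inv_into\<close> recovers x.\<close>
  define f' :: "('h, 'q, 'r) qarr" where
    "f' = \<lparr>qDom = Q, qCod = R,
      qMap = (\<lambda>q\<in>Arr Q. d (src Q q) (dMap f (src Q q) (inv_into (Car X) (e (src Q q)) q)))\<rparr>"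
  have "represents H e Q d R f f'"
    using e d f by (rule representsI) (auto simp: f'_def encodesD[OF e])
  then show ?thesis using that by blast
qed

text \<open>Squares paste along the common identification \<open>d\<close>. Composition of dynamical
  arrows is total, so their composability is a separate premise; for the quiver arrows it comes from
  the shared \<open>R\<close>.\<close>

lemma represents_comp:
  assumes f: "represents H e Q d R f f'" and g: "represents H d R c S g g'"
    and fg: "dDom g = dCod f"
  shows "represents H e Q c S (g \<circ>\<^bsub>H\<^esub> f) (g' \<odot> f')"
proof -
  note F = representsD[OF f] and G = representsD[OF g]
  show ?thesis
  proof (rule representsI[OF F(1) G(2)])
    show "dset_hom H (g \<circ>\<^bsub>H\<^esub> f) (dDom f) (dCod g)"
      using F(3) G(3) fg by (auto intro: dset_hom_comp)
    fix l x assume lx: "l \<in> H" "x \<in> Car (dDom f)"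
    have "dMap f l x \<in> Car (dDom g)" using dset_homD(5)[OF F(3) lx] fg by simp
    then show "qMap (g' \<odot> f') (e l x) = c l (dMap (g \<circ>\<^bsub>H\<^esub> f) l x)"
      using lx F(5,7) G(7) encodesD(3)[OF F(1) lx] by (simp add: qMap_comp dMap_comp)
  qed (use F G in \<open>auto simp: quiv_comp_def compose_def\<close>)
qed

lemma represents_id:
  assumes "encodes H e X Q" shows "represents H e Q e Q (dset_id H X) (quiv_id Q)"
  using assms encodesD[OF assms]
  by (intro representsI[OF assms assms dset_hom_id]) (auto simp: quiv_id_def)

text \<open>Take any representative g' of g. Both g'f' and an identity represent gf, so they are
  equal by uniqueness, and likewise for f'g'. Hence g' is the arrow that \<open>quiv_inv\<close>
  selects.\<close>

lemma represents_inv: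
  assumes f: "represents H e Q d R f f'" and g: "dset_hom H g (dCod f) (dDom f)"
    and gf: "g \<circ>\<^bsub>H\<^esub> f = dset_id H (dDom f)" and fg: "f \<circ>\<^bsub>H\<^esub> g = dset_id H (dCod f)"
  shows "represents H d R e Q g (quiv_inv H f')"
proof -
  note F = representsD[OF f]
  obtain g' where g': "represents H d R e Q g g'"
    using represents_exists[OF F(2,1) g] .
  have "g' \<odot> f' = quiv_id Q"
    using represents_comp[OF f g'] represents_id[OF F(1)] dset_homD(3)[OF g] gf
    by (auto intro: represents_unique)
  moreover have "f' \<odot> g' = quiv_id R"
    using represents_comp[OF g' f] represents_id[OF F(2)] dset_homD(4)[OF g] fg
    by (auto intro: represents_unique)
  ultimately have "quiv_inv H f' = g'"
    using F(4) representsD(4)[OF g'] by (intro quiv_inv_eqI)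
  then show ?thesis using g' by simp
qed

text \<open>The dynamical shift in the tensor product of arrows matches the unshifted
  \<open>map_prod\<close>: the second component is encoded at \<lambda>x before and at
  \<lambda>f(\<lambda>)(x) after, and these agree because f preserves the action.\<close>

lemma represents_tensor:
  assumes f: "represents H e Q e' Q' f f'" and g: "represents H d R d' R' g g'"
  shows "represents H (tensor_enc (dDom f) e d) (Q \<otimes>\<^sub>q R) (tensor_enc (dCod f) e' d') (Q' \<otimes>\<^sub>q R')
    (f \<boxtimes>\<^bsub>H\<^esub> g) (f' \<boxtimes>\<^sub>q g')"
proof -
  note F = representsD[OF f] and G = representsD[OF g]
  note enc = encodes_tensor[OF F(1) G(1)]
  show ?thesis
  proof (rule representsI[OF enc encodes_tensor[OF F(2) G(2)] dset_hom_tensor[OF F(3) G(3)]])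
    fix l p assume l: "l \<in> H" and p: "p \<in> Car (dDom f \<otimes>\<^bsub>H\<^esub> dDom g)"
    show "qMap (f' \<boxtimes>\<^sub>q g') (tensor_enc (dDom f) e d l p)
        = tensor_enc (dCod f) e' d' l (dMap (f \<boxtimes>\<^bsub>H\<^esub> g) l p)"
      using l p encodesD(3)[OF enc l p] F(5,7) G(5,7) dset_homD[OF F(3)]
      by (auto simp: quiv_tensor_arr_def tensor_enc_def)
  qed (use F G in \<open>auto simp: quiv_tensor_arr_def\<close>)
qed

text \<open>Both encodings of a triple run through the same path (x at \<lambda>, y at \<lambda>x, z
  at (\<lambda>x)y) and differ only in bracketing.\<close>

lemma represents_assoc:
  assumes e: "encodes H e X Q" and d: "encodes H d Y R" and c: "encodes H c Z S"
  shows "represents H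
    (tensor_enc (X \<otimes>\<^bsub>H\<^esub> Y) (tensor_enc X e d) c) ((Q \<otimes>\<^sub>q R) \<otimes>\<^sub>q S)
    (tensor_enc X e (tensor_enc Y d c)) (Q \<otimes>\<^sub>q (R \<otimes>\<^sub>q S))
    (dset_assoc H X Y Z) (quiv_assoc Q R S)"
proof -
  note E = encodesD[OF e] and D = encodesD[OF d] and C = encodesD[OF c]
  note enc = encodes_tensor[OF encodes_tensor[OF e d] c]
  show ?thesis
  proof (rule representsI[OF enc encodes_tensor[OF e encodes_tensor[OF d c]]
        dset_hom_assoc[OF E(1) D(1) C(1)]])
    fix l p assume l: "l \<in> H" and p: "p \<in> Car ((X \<otimes>\<^bsub>H\<^esub> Y) \<otimes>\<^bsub>H\<^esub> Z)"
    show "qMap (quiv_assoc Q R S) (tensor_enc (X \<otimes>\<^bsub>H\<^esub> Y) (tensor_enc X e d) c l p)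
        = tensor_enc X e (tensor_enc Y d c) l (dMap (dset_assoc H X Y Z) l p)"
      using l p encodesD(3)[OF enc l p]
      by (auto simp: quiv_assoc_def dset_assoc_def tensor_enc_def)
  qed (auto simp: quiv_assoc_def)
qed

lemma represents_assoc_inv:
  assumes e: "encodes H e X Q" and d: "encodes H d Y R" and c: "encodes H c Z S"
  shows "represents H
    (tensor_enc X e (tensor_enc Y d c)) (Q \<otimes>\<^sub>q (R \<otimes>\<^sub>q S))
    (tensor_enc (X \<otimes>\<^bsub>H\<^esub> Y) (tensor_enc X e d) c) ((Q \<otimes>\<^sub>q R) \<otimes>\<^sub>q S)
    (dset_inv H (dset_assoc H X Y Z)) (quiv_inv H (quiv_assoc Q R S))"
  using dset_assoc_inv[OF encodesD(1)[OF e] encodesD(1)[OF d] encodesD(1)[OF c]]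
  by (intro represents_inv[OF represents_assoc[OF assms]]) (simp_all add: dset_assoc_def)

section \<open>Transport along the monoidal functor\<close>

lemma represents_Qarr:
  assumes f: "dset_hom H f X Y"
  shows "represents H Pair (Qobj H X) Pair (Qobj H Y) f (Qarr H f)"
proof -
  note F = dset_homD[OF f]
  show ?thesis
    by (rule representsI[OF encodes_Qobj[OF F(1)] encodes_Qobj[OF F(2)] f])
      (auto simp: Qarr_def F Qobj_def)
qed

text \<open>The encoding inserts the intermediate vertex \<lambda>x and \<open>phi2\<close> forgets
  it again, leaving (x, y) unchanged.\<close>

lemma represents_phi2:
  assumes X: "dset_obj H X" and Y: "dset_obj H Y"
  shows "represents H (tensor_enc X Pair Pair) (Qobj H X \<otimes>\<^sub>q Qobj H Y)
    Pair (Qobj H (X \<otimes>\<^bsub>H\<^esub> Y)) (dset_id H (X \<otimes>\<^bsub>H\<^esub> Y)) (phi2 H X Y)"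
proof -
  have XY: "dset_obj H (X \<otimes>\<^bsub>H\<^esub> Y)" using X Y by blast
  note enc = encodes_tensor[OF encodes_Qobj[OF X] encodes_Qobj[OF Y]]
  show ?thesis
  proof (rule representsI[OF enc encodes_Qobj[OF XY] dset_hom_id[OF XY]])
    fix l p assume l: "l \<in> H" and p: "p \<in> Car (X \<otimes>\<^bsub>H\<^esub> Y)"
    show "qMap (phi2 H X Y) (tensor_enc X Pair Pair l p) = (l, dMap (dset_id H (X \<otimes>\<^bsub>H\<^esub> Y)) l p)"
      using l p encodesD(3)[OF enc l p] by (auto simp: phi2_def tensor_enc_def)
  qed (auto simp: phi2_def)
qed

text \<open>The outer factors represent identities, so the conjugate represents f itself. This makes
  \<sigma>' and k' representatives of \<sigma> and k.\<close>

lemma represents_conj_phi2: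
  assumes X: "dset_obj H X" and Y: "dset_obj H Y" and Z: "dset_obj H Z" and W: "dset_obj H W"
    and f: "dset_hom H f (X \<otimes>\<^bsub>H\<^esub> Y) (Z \<otimes>\<^bsub>H\<^esub> W)"
  shows "represents H (tensor_enc X Pair Pair) (Qobj H X \<otimes>\<^sub>q Qobj H Y)
    (tensor_enc Z Pair Pair) (Qobj H Z \<otimes>\<^sub>q Qobj H W)
    f (quiv_inv H (phi2 H Z W) \<odot> Qarr H f \<odot> phi2 H X Y)"
proof -
  have id: "dset_hom H (dset_id H (Z \<otimes>\<^bsub>H\<^esub> W)) (Z \<otimes>\<^bsub>H\<^esub> W) (Z \<otimes>\<^bsub>H\<^esub> W)"
    using Z W by (blast intro: dset_hom_id)
  have "represents H Pair (Qobj H (Z \<otimes>\<^bsub>H\<^esub> W)) (tensor_enc Z Pair Pair) (Qobj H Z \<otimes>\<^sub>q Qobj H W)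
    (dset_id H (Z \<otimes>\<^bsub>H\<^esub> W)) (quiv_inv H (phi2 H Z W))"
    \<comment> \<open>The identity is its own inverse.\<close>
    by (rule represents_inv[OF represents_phi2[OF Z W]])
      (simp_all add: dset_homD[OF id] id dset_id_comp[OF id])
  moreover have "represents H (tensor_enc X Pair Pair) (Qobj H X \<otimes>\<^sub>q Qobj H Y)
    Pair (Qobj H (Z \<otimes>\<^bsub>H\<^esub> W)) (f \<circ>\<^bsub>H\<^esub> dset_id H (X \<otimes>\<^bsub>H\<^esub> Y)) (Qarr H f \<odot> phi2 H X Y)"
    by (rule represents_comp[OF represents_phi2[OF X Y] represents_Qarr[OF f]])
      (simp add: dset_homD[OF f] dset_id_def)
  ultimately have "represents H (tensor_enc X Pair Pair) (Qobj H X \<otimes>\<^sub>q Qobj H Y)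
    (tensor_enc Z Pair Pair) (Qobj H Z \<otimes>\<^sub>q Qobj H W)
    (dset_id H (Z \<otimes>\<^bsub>H\<^esub> W) \<circ>\<^bsub>H\<^esub> f) (quiv_inv H (phi2 H Z W) \<odot> Qarr H f \<odot> phi2 H X Y)"
    by (intro represents_comp) (simp_all add: dset_homD[OF id] dset_homD[OF f] dset_comp_id[OF f])
  then show ?thesis
    by (simp add: dset_id_comp[OF f])
qed

section \<open>The reflection equation for quivers\<close>

theorem proposition9p2:
  fixes H :: "'h set"
    and L :: "('h, 'l) dset" and X :: "('h, 'x) dset"
    and \<sigma> :: "('h, 'l \<times> 'l, 'l \<times> 'l) darr" and k :: "('h, 'l \<times> 'x, 'l \<times> 'x) darr"
  assumes "H \<noteq> {}"
    and "dset_obj H L" and "dset_obj H X"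
    and "dynamical_YB_map H L \<sigma>"
    and "dynamical_reflection_map H L X \<sigma> k"
  shows
    "let QL = Qobj H L; QX = Qobj H X;
         \<sigma>' = quiv_inv H (phi2 H L L) \<odot> Qarr H \<sigma> \<odot> phi2 H L L;
         k' = quiv_inv H (phi2 H L X) \<odot> Qarr H k \<odot> phi2 H L X;
         a = quiv_assoc QL QL QX; a' = quiv_inv H a;
         s = \<sigma>' \<boxtimes>\<^sub>q quiv_id QX; r = quiv_id QL \<boxtimes>\<^sub>q k'
     in quiv_hom H \<sigma>' (QL \<otimes>\<^sub>q QL) (QL \<otimes>\<^sub>q QL) \<and>
        quiv_hom H k' (QL \<otimes>\<^sub>q QX) (QL \<otimes>\<^sub>q QX) \<and>
        a' \<odot> r \<odot> a \<odot> s \<odot> a' \<odot> r \<odot> a \<odot> s \<odot> a'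
          = s \<odot> a' \<odot> r \<odot> a \<odot> s \<odot> a' \<odot> r"
proof -
  note L = \<open>dset_obj H L\<close> and X = \<open>dset_obj H X\<close>
  define QL QX where "QL = Qobj H L" and "QX = Qobj H X"
  define \<sigma>' k' where "\<sigma>' = quiv_inv H (phi2 H L L) \<odot> Qarr H \<sigma> \<odot> phi2 H L L"
    and "k' = quiv_inv H (phi2 H L X) \<odot> Qarr H k \<odot> phi2 H L X"
  define a' ai' s' r' where "a' = quiv_assoc QL QL QX" and "ai' = quiv_inv H a'"
    and "s' = \<sigma>' \<boxtimes>\<^sub>q quiv_id QX" and "r' = quiv_id QL \<boxtimes>\<^sub>q k'"
  define a ai s r where "a = dset_assoc H L L X" and "ai = dset_inv H a"
    and "s = \<sigma> \<boxtimes>\<^bsub>H\<^esub> dset_id H X" and "r = dset_id H L \<boxtimes>\<^bsub>H\<^esub> k"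
  \<comment> \<open>\<open>U\<close> and \<open>V\<close> encode triples as paths bracketed to the
    left and to the right. They are the identifications at the two ends of the associator; s lives
    over \<open>U\<close> and r over \<open>V\<close>.\<close>
  define U where "U = tensor_enc (L \<otimes>\<^bsub>H\<^esub> L) (tensor_enc L Pair Pair) (Pair :: 'h \<Rightarrow> 'x \<Rightarrow> 'h \<times> 'x)"
  define V where "V = tensor_enc L Pair (tensor_enc L Pair (Pair :: 'h \<Rightarrow> 'x \<Rightarrow> 'h \<times> 'x))"
  define QU QV where "QU = (QL \<otimes>\<^sub>q QL) \<otimes>\<^sub>q QX" and "QV = QL \<otimes>\<^sub>q (QL \<otimes>\<^sub>q QX)"
  have \<sigma>: "dset_hom H \<sigma> (L \<otimes>\<^bsub>H\<^esub> L) (L \<otimes>\<^bsub>H\<^esub> L)" and k: "dset_hom H k (L \<otimes>\<^bsub>H\<^esub> X) (L \<otimes>\<^bsub>H\<^esub> X)"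
    and eq: "ai \<circ>\<^bsub>H\<^esub> r \<circ>\<^bsub>H\<^esub> a \<circ>\<^bsub>H\<^esub> s \<circ>\<^bsub>H\<^esub> ai \<circ>\<^bsub>H\<^esub> r \<circ>\<^bsub>H\<^esub> a \<circ>\<^bsub>H\<^esub> s \<circ>\<^bsub>H\<^esub> ai
      = s \<circ>\<^bsub>H\<^esub> ai \<circ>\<^bsub>H\<^esub> r \<circ>\<^bsub>H\<^esub> a \<circ>\<^bsub>H\<^esub> s \<circ>\<^bsub>H\<^esub> ai \<circ>\<^bsub>H\<^esub> r"
    using assms(4,5)
    by (simp_all add: dynamical_YB_map_def dynamical_reflection_map_def Let_def
        a_def ai_def s_def r_def)
  note eL = encodes_Qobj[OF L, folded QL_def] and eX = encodes_Qobj[OF X, folded QX_def]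
  have R\<sigma>: "represents H (tensor_enc L Pair Pair) (QL \<otimes>\<^sub>q QL) (tensor_enc L Pair Pair) (QL \<otimes>\<^sub>q QL) \<sigma> \<sigma>'"
    unfolding QL_def \<sigma>'_def using L L L L \<sigma> by (rule represents_conj_phi2)
  have Rk: "represents H (tensor_enc L Pair Pair) (QL \<otimes>\<^sub>q QX) (tensor_enc L Pair Pair) (QL \<otimes>\<^sub>q QX) k k'"
    unfolding QL_def QX_def k'_def using L X L X k by (rule represents_conj_phi2)
  have Rs: "represents H U QU U QU s s'"
    using represents_tensor[OF R\<sigma> represents_id[OF eX]] dset_homD(3,4)[OF \<sigma>]
    by (simp add: U_def QU_def s_def s'_def)
  have Rr: "represents H V QV V QV r r'"
    using represents_tensor[OF represents_id[OF eL] Rk]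
    by (simp add: V_def QV_def r_def r'_def dset_id_def)
  have Ra: "represents H U QU V QV a a'"
    using represents_assoc[OF eL eL eX] by (simp add: U_def V_def QU_def QV_def a_def a'_def)
  have Rai: "represents H V QV U QU ai ai'"
    using represents_assoc_inv[OF eL eL eX]
    by (simp add: U_def V_def QU_def QV_def a_def a'_def ai_def ai'_def)
  define TU TV where "TU = (L \<otimes>\<^bsub>H\<^esub> L) \<otimes>\<^bsub>H\<^esub> X" and "TV = L \<otimes>\<^bsub>H\<^esub> (L \<otimes>\<^bsub>H\<^esub> X)"
  \<comment> \<open>Domains and codomains discharge the composability premises of
    \<open>represents_comp\<close>.\<close>
  have dc: "dDom s = TU" "dCod s = TU" "dDom r = TV" "dCod r = TV"
    "dDom a = TU" "dCod a = TV" "dDom ai = TV" "dCod ai = TU"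
    using dset_homD(3,4)[OF \<sigma>] dset_homD(3,4)[OF k] dset_homD(3,4)[OF dset_assoc_inv(1)[OF L L X]]
    by (simp_all add: TU_def TV_def s_def r_def a_def ai_def dset_tensor_arr_def dset_id_def
        dset_assoc_def)
  have dc_comp: "dDom (g \<circ>\<^bsub>H\<^esub> f) = dDom f" "dCod (g \<circ>\<^bsub>H\<^esub> f) = dCod g"
    for f :: "('h, 'u, 'v) darr" and g :: "('h, 'v, 'w) darr"
    by (simp_all add: dset_comp_def)
  note R = Rs Rr Ra Rai
  have lhs: "represents H V QV U QU (ai \<circ>\<^bsub>H\<^esub> r \<circ>\<^bsub>H\<^esub> a \<circ>\<^bsub>H\<^esub> s \<circ>\<^bsub>H\<^esub> ai \<circ>\<^bsub>H\<^esub> r \<circ>\<^bsub>H\<^esub> a \<circ>\<^bsub>H\<^esub> s \<circ>\<^bsub>H\<^esub> ai)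
    (ai' \<odot> r' \<odot> a' \<odot> s' \<odot> ai' \<odot> r' \<odot> a' \<odot> s' \<odot> ai')"
    \<comment> \<open>Composition associates to the right, so each application splits off the
      leftmost factor. The facts \<open>R\<close> determine whether \<open>U\<close> or
      \<open>V\<close> stands at each intermediate place.\<close>
    by (rule represents_comp R | simp only: dc dc_comp)+
  have rhs: "represents H V QV U QU (s \<circ>\<^bsub>H\<^esub> ai \<circ>\<^bsub>H\<^esub> r \<circ>\<^bsub>H\<^esub> a \<circ>\<^bsub>H\<^esub> s \<circ>\<^bsub>H\<^esub> ai \<circ>\<^bsub>H\<^esub> r)
    (s' \<odot> ai' \<odot> r' \<odot> a' \<odot> s' \<odot> ai' \<odot> r')"
    by (rule represents_comp R | simp only: dc dc_comp)+
  \<comment> \<open>After rewriting with the reflection equation for k, both quiver composites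
    represent one and the same dynamical arrow from \<open>V\<close> to \<open>U\<close>.\<close>
  have "ai' \<odot> r' \<odot> a' \<odot> s' \<odot> ai' \<odot> r' \<odot> a' \<odot> s' \<odot> ai' = s' \<odot> ai' \<odot> r' \<odot> a' \<odot> s' \<odot> ai' \<odot> r'"
    using lhs[unfolded eq] rhs by (rule represents_unique)
  then show ?thesis
    using representsD(4)[OF R\<sigma>] representsD(4)[OF Rk]
    by (simp add: Let_def QL_def QX_def \<sigma>'_def k'_def a'_def ai'_def s'_def r'_def)
qed

end
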